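(* For every integer $n\ge 0$, $c_4(n)$ is odd if $n=(7j^2+3j)/2$ for some $j\in\mathbb{Z}$, and $c_4(n)$ is even otherwise.
   Context: A partition of $n\ge 0$ is a finite multiset of positive integers summing to $n$; the empty partition is the partition of $0$. For $n\ge 0$, $c_4(n)$ denotes the number of partitions $\lambda$ of $n$ such that either (a) all parts of $\lambda$ are even and distinct, or (b) there is an integer $j\ge 1$ such that each of $2,4,\dots,2j$ appears in $\lambda$ exactly twice, every even part greater than $2j$ is at least $4j+2$ and appears at most once, and every odd part is at most $2j-1$ and appears at most once. *)

theory Defs
  imports Main "HOL-Library.Multiset"
begin

definition is_partition :: "nat \<Rightarrow> nat multiset \<Rightarrow> bool" where
  "is_partition n p \<longleftrightarrow> (\<forall>x\<in>#p. 0 < x) \<and> sum_mset p = n"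

definition c4_condA :: "nat multiset \<Rightarrow> bool" where
  "c4_condA p \<longleftrightarrow> (\<forall>x\<in>#p. even x \<and> count p x = 1)"

definition c4_condB :: "nat \<Rightarrow> nat multiset \<Rightarrow> bool" where
  "c4_condB j p \<longleftrightarrow> 1 \<le> j
     \<and> (\<forall>i\<in>{1..j}. count p (2 * i) = 2)
     \<and> (\<forall>x\<in>#p. even x \<and> x > 2 * j \<longrightarrow> x \<ge> 4 * j + 2 \<and> count p x \<le> 1)
     \<and> (\<forall>x\<in>#p. odd x \<longrightarrow> x \<le> 2 * j - 1 \<and> count p x \<le> 1)"

definition c4 :: "nat \<Rightarrow> nat" where
  "c4 n = card {p. is_partition n p \<and> (c4_condA p \<or> (\<exists>j. c4_condB j p))}"

end

theory Submission
  imports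
    Defs
    "HOL-Computational_Algebra.Formal_Power_Series"
    "HOL-Library.Z2"
begin

text \<open>
  The generating function of \<open>c4\<close> is
  \<open>\<Sum>\<^sub>j q\<^bsup>2j(j+1)\<^esup> (1+q)(1+q\<^sup>3)\<dots>(1+q\<^bsup>2j-1\<^esup>) (1+q\<^bsup>4j+2\<^esup>)(1+q\<^bsup>4j+4\<^esup>)\<dots>\<close>.
  Modulo 2 all signs may be changed, and then the series is \<open>(q\<^sup>2;q\<^sup>2)\<^sub>\<infinity>\<close> times the sum side of a
  Rogers-Selberg identity modulo 7, hence the theta series
  \<open>\<Sum>\<^sub>j (-1)\<^sup>j q\<^bsup>(7j\<^sup>2+3j)/2\<^esup>\<close> over all integers \<open>j\<close>, whose exponents are pairwise distinct.

  The identity is proved with Bailey's lemma. The term \<open>(q;q\<^sup>2)\<^sub>j / (q\<^sup>2;q\<^sup>2)\<^sub>2\<^sub>j\<close> is expanded as a finite sum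
  of \<open>(-1)\<^sup>r q\<^bsup>r(3r-1)/2\<^esup> (1-q\<^bsup>4r+2\<^esup>) / ((q\<^sup>2;q\<^sup>2)\<^sub>j\<^sub>-\<^sub>r (q\<^sup>2;q\<^sup>2)\<^sub>j\<^sub>+\<^sub>r\<^sub>+\<^sub>1)\<close>, which
  satisfies a first-order recurrence in \<open>j\<close> by creative telescoping. After interchanging the sums, the
  inner sum over \<open>j\<close> is evaluated by Cauchy's Durfee rectangle identity
  \<open>\<Sum>\<^sub>m q\<^bsup>2m(m+c)\<^esup> / ((q\<^sup>2;q\<^sup>2)\<^sub>m (q\<^sup>2;q\<^sup>2)\<^sub>m\<^sub>+\<^sub>c) = 1 / (q\<^sup>2;q\<^sup>2)\<^sub>\<infinity>\<close>.
  Infinite sums and products are avoided by working modulo a power of \<open>q\<close>.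
\<close>

section \<open>A Bailey pair\<close>

text \<open>With \<open>q = fps_X\<close> this is the q-Pochhammer symbol
  \<open>(q^2;q^2)_k\<close>; \<open>odd_poch\<close> is \<open>(q;q^2)_k\<close>.\<close>

definition even_poch :: "nat \<Rightarrow> 'a::field fps" where
  "even_poch k = (\<Prod>i=1..k. 1 - fps_X ^ (2 * i))"

definition odd_poch :: "nat \<Rightarrow> 'a::field fps" where
  "odd_poch k = (\<Prod>i=1..k. 1 - fps_X ^ (2 * i - 1))"

definition inv_poch :: "nat \<Rightarrow> 'a::field fps" where
  "inv_poch k = inverse (even_poch k)"

lemma even_poch_0 [simp]: "even_poch 0 = 1"
  by (simp add: even_poch_def)

lemma even_poch_Suc: "even_poch (Suc k) = even_poch k * (1 - fps_X ^ (2 * k + 2))"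
  by (simp add: even_poch_def)

lemma odd_poch_Suc: "odd_poch (Suc k) = odd_poch k * (1 - fps_X ^ (2 * k + 1))"
  by (simp add: odd_poch_def)

lemma even_poch_nth_0 [simp]: "fps_nth (even_poch k) 0 = 1"
  by (induction k) (simp_all add: even_poch_Suc)

lemma inv_poch_mult [simp]: "inv_poch k * even_poch k = 1" "even_poch k * inv_poch k = 1"
  by (simp_all add: inv_poch_def inverse_mult_eq_1 inverse_mult_eq_1')

lemma inv_poch_0 [simp]: "inv_poch 0 = 1"
  by (simp add: inv_poch_def)

text \<open>Used from left to right to raise indices: reciprocals with neighbouring indices get a
  common factor, and what remains is polynomial.\<close>

lemma inv_poch_rec: "inv_poch k = (1 - fps_X ^ (2 * k + 2)) * inv_poch (Suc k)"
proof -
  have "(1 - fps_X ^ (2 * k + 2)) * inv_poch (Suc k)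
      = inv_poch k * (even_poch (Suc k) * inv_poch (Suc k) :: 'a fps)"
    unfolding even_poch_Suc by (simp only: mult.assoc [symmetric] inv_poch_mult mult_1_left)
  then show ?thesis by simp
qed

text \<open>Terms of Euler's pentagonal number series. At \<open>r = 0\<close> the truncated
  \<open>3 * r - 1\<close> is harmless because of the factor \<open>r\<close>.\<close>

definition pent_weight :: "nat \<Rightarrow> 'a::field fps" where
  "pent_weight r = (-1) ^ r * fps_X ^ (r * (3 * r - 1) div 2)"

lemma pent_weight_0 [simp]: "pent_weight 0 = 1"
  by (simp add: pent_weight_def)

lemma pent_weight_Suc: "pent_weight (Suc r) = - (fps_X ^ (3 * r + 1) * pent_weight r)"
proof -
  have "Suc r * (3 * Suc r - 1) = r * (3 * r - 1) + 2 * (3 * r + 1)"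
    by (cases r) (simp_all add: algebra_simps)
  then have "Suc r * (3 * Suc r - 1) div 2 = r * (3 * r - 1) div 2 + (3 * r + 1)"
    by simp
  then show ?thesis
    by (simp add: pent_weight_def power_add mult_ac)
qed

text \<open>Summed over \<open>r\<close>, this is the Bailey pair relation with base \<open>q\<^sup>2\<close> and \<open>a = q\<^sup>2\<close>, cleared of
  the factor \<open>1 - q\<^sup>2\<close>.\<close>

definition bailey_term :: "nat \<Rightarrow> nat \<Rightarrow> 'a::field fps" where
  "bailey_term n r = pent_weight r * (1 - fps_X ^ (4 * r + 2)) * inv_poch (n - r) * inv_poch (n + r + 1)"

text \<open>With \<open>s = q\<^sup>n\<close> and \<open>y = q\<^sup>r\<close>; obtained by comparing coefficients of the powers of \<open>y\<close> in
  the telescoping equation \<open>bailey_term_telescope\<close>.\<close>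

definition wz_poly :: "'a::comm_ring_1 \<Rightarrow> 'a \<Rightarrow> 'a \<Rightarrow> 'a" where
  "wz_poly q s y = q * s^2 * y + q^3 * s^4 * y^2 + (q^2 * s^2 - q^5 * s^4) * y^3
     + (q^6 * s^4 - q^3 * s^2) * y^4 - q^6 * s^4 * y^5 - q^6 * s^2 * y^6"

definition wz_cert :: "nat \<Rightarrow> nat \<Rightarrow> 'a::field fps" where
  "wz_cert n r = wz_poly fps_X (fps_X ^ n) (fps_X ^ r) * pent_weight r
     * inv_poch (n - r) * inv_poch (n + r + 2)"

text \<open>Each new summand is the difference of two consecutive certificates. Over common
  reciprocals this becomes a polynomial identity. The bound on \<open>R\<close> keeps
  \<open>n - r\<close> from being truncated.\<close>

lemma bailey_term_telescope:
  assumes "R \<le> n"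
  shows "(\<Sum>r\<le>R. (1 - fps_X ^ (4 * n + 4)) * (1 + fps_X ^ (2 * n + 1)) * bailey_term (Suc n) r
           - bailey_term n r) = (wz_cert n R :: 'a::field fps)"
  using assms
proof (induction R)
  case 0
  define q s A B :: "'a fps" where "q = fps_X" and "s = fps_X ^ n"
    and "A = inv_poch (Suc n)" and "B = inv_poch (n + 2)"
  have A: "inv_poch n = (1 - q^2 * s^2) * A"
    unfolding inv_poch_rec [of n] A_def q_def s_def by (simp add: power_add power_mult mult_ac power2_eq_square)
  have B: "A = (1 - q^4 * s^2) * B"
    unfolding inv_poch_rec [of "Suc n"] A_def B_def q_def s_def
    by (simp add: power_add power_mult mult_ac power2_eq_square eval_nat_numeral)
  have X: "fps_X ^ (4 * n + 4) = q^4 * s^4" "fps_X ^ (2 * n + 1) = q * s^2"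
    unfolding q_def s_def power_mult [symmetric] power_add [symmetric] power_Suc [symmetric]
    by (rule arg_cong [of _ _ "power fps_X"], simp add: algebra_simps)+
  have t1: "bailey_term (Suc n) 0 = (1 - q^2) * A * B"
    by (simp add: bailey_term_def A_def B_def q_def power2_eq_square)
  have t2: "bailey_term n 0 = (1 - q^2) * ((1 - q^2 * s^2) * A) * A"
    unfolding A[symmetric] by (simp add: bailey_term_def A_def q_def power2_eq_square)
  have t3: "wz_cert n 0 = wz_poly q s 1 * ((1 - q^2 * s^2) * A) * B"
    unfolding A[symmetric] by (simp add: wz_cert_def B_def q_def s_def)
  have "(1 - q^4 * s^4) * (1 + q * s^2) * bailey_term (Suc n) 0 - bailey_term n 0 = wz_cert n 0"
    unfolding t1 t2 t3 B wz_poly_def power_one mult_1_right by algebra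
  then show ?case
    by (simp only: X atMost_0 sum.insert finite.emptyI sum.empty empty_iff add_0_right not_False_eq_True)
next
  case (Suc R)
  then obtain d where n: "n = Suc R + d"
    using le_Suc_ex by blast
  define q y z s A B W :: "'a fps" where "q = fps_X" and "y = fps_X ^ R" and "z = fps_X ^ d"
    and "s = fps_X ^ n"
    and "A = inv_poch (Suc d)" and "B = inv_poch (n + R + 3)" and "W = pent_weight R"
  \<comment> \<open>Eliminating \<open>s\<close> leaves an identity in \<open>q\<close>,
    \<open>y\<close>, \<open>z\<close> and the common factors \<open>A\<close>, \<open>B\<close>,
    \<open>W\<close>.\<close>
  have s: "s = q * y * z"
    by (simp add: s_def n q_def y_def z_def power_add)
  have A: "inv_poch d = (1 - q^2 * z^2) * A"
    unfolding inv_poch_rec [of d] A_def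
    by (simp add: q_def z_def mult_ac flip: power_mult power_add)
  have B: "inv_poch (n + R + 2) = (1 - q^6 * s^2 * y^2) * B"
  proof -
    have "fps_X ^ (2 * (n + R + 2) + 2) = q^6 * s^2 * y^2"
      unfolding q_def s_def y_def power_mult [symmetric] power_add [symmetric] power_Suc [symmetric]
      by (rule arg_cong [of _ _ "power fps_X"], simp add: algebra_simps)+
    moreover have "Suc (n + R + 2) = n + R + 3" by simp
    ultimately show ?thesis
      using inv_poch_rec [of "n + R + 2", where 'a = 'a] by (simp only: B_def)
  qed
  have W: "pent_weight (Suc R) = - (q * y^3 * W)"
    unfolding pent_weight_Suc W_def
    by (simp add: q_def y_def power_add mult_ac flip: power_mult)
  have X: "fps_X ^ (4 * n + 4) = q^4 * s^4" "fps_X ^ (2 * n + 1) = q * s^2"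
      "fps_X ^ (4 * Suc R + 2) = q^6 * y^4" "fps_X ^ Suc R = q * y"
    unfolding q_def s_def y_def power_mult [symmetric] power_add [symmetric] power_Suc [symmetric]
    by (rule arg_cong [of _ _ "power fps_X"], simp add: algebra_simps)+
  have t1: "bailey_term (Suc n) (Suc R) = - (q * y^3 * W) * (1 - q^6 * y^4) * A * B"
    unfolding bailey_term_def W X by (simp add: n A_def B_def numeral_3_eq_3 add_ac)
  have t2: "bailey_term n (Suc R)
      = - (q * y^3 * W) * (1 - q^6 * y^4) * ((1 - q^2 * z^2) * A) * ((1 - q^6 * s^2 * y^2) * B)"
    unfolding bailey_term_def W X by (simp add: n add_ac flip: A B)
  have t3: "wz_cert n R = wz_poly q s y * W * A * ((1 - q^6 * s^2 * y^2) * B)"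
  proof -
    have "n - R = Suc d" by (simp add: n)
    then show ?thesis
      unfolding wz_cert_def B by (simp only: q_def s_def y_def W_def A_def)
  qed
  have t4: "wz_cert n (Suc R) = wz_poly q s (q * y) * (- (q * y^3 * W)) * ((1 - q^2 * z^2) * A) * B"
    unfolding wz_cert_def W X by (simp add: n flip: A) (simp add: q_def s_def n B_def numeral_3_eq_3)
  have "(\<Sum>r\<le>Suc R. (1 - fps_X ^ (4 * n + 4)) * (1 + fps_X ^ (2 * n + 1)) * bailey_term (Suc n) r
           - bailey_term n r)
       = wz_cert n R + ((1 - q^4 * s^4) * (1 + q * s^2) * bailey_term (Suc n) (Suc R) - bailey_term n (Suc R))"
    using Suc by (simp add: X(1,2)[simplified])
  also have "\<dots> = wz_cert n (Suc R)"
    unfolding t1 t2 t3 t4 wz_poly_def s by algebra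
  finally show ?case .
qed

definition bailey_sum :: "nat \<Rightarrow> 'a::field fps" where
  "bailey_sum n = (\<Sum>r\<le>n. bailey_term n r)"

text \<open>Telescoping covers only \<open>r\<close> \<le> \<open>n\<close>. The remaining summand
  \<open>r = n + 1\<close> of \<open>bailey_sum (Suc n)\<close> cancels the boundary value
  \<open>wz_cert n n\<close>.\<close>

lemma bailey_sum_rec:
  "(1 - fps_X ^ (4 * n + 4)) * (1 + fps_X ^ (2 * n + 1)) * bailey_sum (Suc n) = (bailey_sum n :: 'a::field fps)"
proof -
  define q s B :: "'a fps" where "q = fps_X" and "s = fps_X ^ n" and "B = inv_poch (2 * n + 3)"
  define c where "c = (1 - fps_X ^ (4 * n + 4)) * (1 + fps_X ^ (2 * n + 1) :: 'a fps)"
  have X: "fps_X ^ (4 * n + 4) = q^4 * s^4" "fps_X ^ (2 * n + 1) = q * s^2"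
      "fps_X ^ (4 * Suc n + 2) = q^6 * s^4"
    unfolding q_def s_def power_mult [symmetric] power_add [symmetric] power_Suc [symmetric]
    by (rule arg_cong [of _ _ "power fps_X"], simp add: algebra_simps)+
  have B: "inv_poch (n + n + 2) = (1 - q^6 * s^4) * B"
  proof -
    have "fps_X ^ (2 * (n + n + 2) + 2) = q^6 * s^4"
      unfolding q_def s_def power_mult [symmetric] power_add [symmetric] power_Suc [symmetric]
      by (rule arg_cong [of _ _ "power fps_X"], simp add: algebra_simps)+
    moreover have "Suc (n + n + 2) = 2 * n + 3" by simp
    ultimately show ?thesis
      using inv_poch_rec [of "n + n + 2", where 'a = 'a] by (simp only: B_def)
  qed
  have W: "pent_weight (Suc n) = - (q * s^3 * pent_weight n)"
    unfolding pent_weight_Suc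
    by (simp add: q_def s_def power_add mult_ac flip: power_mult)
  have B': "inv_poch (Suc n + Suc n + 1) = B"
    unfolding B_def by (rule arg_cong [of _ _ inv_poch]) simp
  have "c * bailey_sum (Suc n) - bailey_sum n
      = (\<Sum>r\<le>n. c * bailey_term (Suc n) r - bailey_term n r) + c * bailey_term (Suc n) (Suc n)"
    by (simp add: bailey_sum_def sum_subtractf sum_distrib_left algebra_simps)
  also have "(\<Sum>r\<le>n. c * bailey_term (Suc n) r - bailey_term n r) = wz_cert n n"
    unfolding c_def by (rule bailey_term_telescope) simp
  also have "wz_cert n n = wz_poly q s s * pent_weight n * ((1 - q^6 * s^4) * B)"
    by (simp add: wz_cert_def q_def s_def flip: B[simplified q_def s_def])
  also have "c * bailey_term (Suc n) (Suc n) =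
     (1 - q^4 * s^4) * (1 + q * s^2) * (- (q * s^3 * pent_weight n) * (1 - q^6 * s^4) * B)"
    unfolding c_def bailey_term_def X W B' by simp
  also have "wz_poly q s s * pent_weight n * ((1 - q^6 * s^4) * B) + \<dots> = 0"
    unfolding wz_poly_def by algebra
  finally show ?thesis by (simp add: c_def)
qed

lemma bailey_sum_eq: "bailey_sum n * even_poch (2 * n) = odd_poch n"
proof (induction n)
  case 0
  have "(1 - fps_X ^ 2) * inv_poch (Suc 0) = (1 :: 'a fps)"
    using inv_poch_rec [of 0, where 'a = 'a] by (simp add: power2_eq_square)
  then show ?case
    by (simp add: bailey_sum_def bailey_term_def odd_poch_def power2_eq_square)
next
  case (Suc n)
  have e: "even_poch (2 * Suc n) = even_poch (2 * n) * (1 - fps_X ^ (4 * n + 2)) * (1 - fps_X ^ (4 * n + 4) :: 'a fps)"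
  proof -
    have "2 * Suc n = Suc (Suc (2 * n))" "2 * (2 * n) + 2 = 4 * n + 2"
      "2 * Suc (2 * n) + 2 = 4 * n + 4"
      by simp_all
    then show ?thesis by (simp only: even_poch_Suc)
  qed
  \<comment> \<open>One factor is absorbed by \<open>bailey_sum_rec\<close>, the other extends
    \<open>odd_poch\<close>.\<close>
  have f: "1 - fps_X ^ (4 * n + 2) = (1 - fps_X ^ (2 * n + 1)) * (1 + fps_X ^ (2 * n + 1) :: 'a fps)"
    by (simp add: algebra_simps flip: power_add)
  have "bailey_sum (Suc n) * even_poch (2 * Suc n)
    = ((1 - fps_X ^ (4 * n + 4)) * (1 + fps_X ^ (2 * n + 1)) * bailey_sum (Suc n)) * even_poch (2 * n) * (1 - fps_X ^ (2 * n + 1) :: 'a fps)"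
    unfolding e f by (simp only: mult_ac)
  then show ?case
    by (simp only: bailey_sum_rec Suc odd_poch_Suc)
qed

section \<open>The Durfee rectangle identity\<close>

text \<open>Partitions, counted with \<open>q^2\<close> in place of \<open>q\<close>, sorted by
  their Durfee rectangle of size \<open>m\<close> by \<open>m + c\<close>, up to
  \<open>m = L\<close>.\<close>

definition durfee_sum :: "nat \<Rightarrow> nat \<Rightarrow> 'a::field fps" where
  "durfee_sum L c = (\<Sum>m\<le>L. fps_X ^ (2 * m * (m + c)) * inv_poch m * inv_poch (m + c))"

text \<open>The product subtracted in the bracket is the top summand of
  \<open>durfee_sum L (c + 2)\<close>: it is the truncation error in the three-term relation of the
  infinite sums.\<close>

lemma durfee_sum_rec:
  "durfee_sum L c - durfee_sum L (c + 1)
     = fps_X ^ (2 * c + 2) * (durfee_sum L (c + 2) - durfee_sum L (c + 1)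
         - fps_X ^ (2 * L * (L + c + 2)) * inv_poch L * inv_poch (L + c + 2) :: 'a::field fps)"
proof (induction L)
  case 0
  have "inv_poch c = (1 - fps_X ^ (2 * c + 2)) * (inv_poch (c + 1) :: 'a fps)"
    using inv_poch_rec[of c, where 'a = 'a] by simp
  then show ?case
    by (simp add: durfee_sum_def algebra_simps)
next
  case (Suc L)
  define q l C A B :: "'a fps" where "q = fps_X" and "l = fps_X ^ L" and "C = fps_X ^ c"
    and "A = inv_poch (Suc L)" and "B = inv_poch (L + c + 2)"
  define E where "E = (fps_X ^ (2 * L * (L + c)) :: 'a fps)"
  have E: "fps_X ^ (2 * Suc L * (Suc L + c)) = E * l^4 * C^2 * q^2"
     "fps_X ^ (2 * Suc L * (Suc L + (c + 1))) = E * l^6 * C^2 * q^4"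
     "fps_X ^ (2 * L * (L + c + 2)) = E * l^4"
    unfolding E_def l_def C_def q_def power_mult [symmetric] power_add [symmetric] power_Suc [symmetric]
    by (rule arg_cong [of _ _ "power fps_X"], simp add: algebra_simps)+
  have X: "fps_X ^ (2 * c + 2) = C^2 * q^2"
    unfolding C_def q_def power_mult [symmetric] power_add [symmetric] power_Suc [symmetric]
    by (rule arg_cong [of _ _ "power fps_X"], simp add: algebra_simps)+
  have A: "inv_poch L = (1 - q^2 * l^2) * A"
    unfolding inv_poch_rec [of L] A_def
    by (simp add: q_def l_def mult_ac flip: power_mult power_add)
  have B: "inv_poch (Suc L + c) = (1 - q^4 * l^2 * C^2) * B"
  proof -
    have "fps_X ^ (2 * (Suc L + c) + 2) = q^4 * l^2 * C^2"
      unfolding q_def l_def C_def power_mult [symmetric] power_add [symmetric] power_Suc [symmetric]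
      by (rule arg_cong [of _ _ "power fps_X"], simp add: algebra_simps)+
    moreover have "Suc (Suc L + c) = L + c + 2" by simp
    ultimately show ?thesis
      using inv_poch_rec [of "Suc L + c", where 'a = 'a] by (simp only: B_def)
  qed
  have B': "inv_poch (Suc L + (c + 1)) = B"
    by (simp add: B_def)
  have S: "durfee_sum (Suc L) c' = durfee_sum L c' +
     fps_X ^ (2 * Suc L * (Suc L + c')) * A * inv_poch (Suc L + c')" for c'
    by (simp add: durfee_sum_def A_def)
  \<comment> \<open>The new top summand for shift \<open>c + 2\<close> cancels against the new
    boundary term, so its factors stay opaque.\<close>
  define Y Z :: "'a fps" where "Y = inv_poch (Suc L + (c + 2))"
    and "Z = fps_X ^ (2 * Suc L * (Suc L + (c + 2)))"
  show ?case
    using Suc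
    unfolding S X E A B B' B_def [symmetric] A_def [symmetric] add.assoc[of "Suc L" c 2]
      Y_def [symmetric] Z_def [symmetric]
    by algebra
qed

lemma fps_X_power_dvd: "k \<le> m \<Longrightarrow> fps_X ^ k dvd (fps_X ^ m * f :: 'a::field fps)"
  by (simp add: dvd_mult2 le_imp_power_dvd)

text \<open>By \<open>durfee_sum_rec\<close> the difference of consecutive sums is, up to the boundary term, a multiple
  \<open>- q\<^bsup>2c+2\<^esup>\<close> of the next difference, hence divisible by every power of \<open>q\<close>.\<close>

lemma durfee_sum_cong_Suc:
  assumes "K \<le> L"
  shows "fps_X ^ Suc K dvd durfee_sum L c - (durfee_sum L (c + 1) :: 'a::field fps)"
\<comment> \<open>Downward induction on \<open>c\<close>, starting where \<open>c\<close> \<ge>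
  \<open>K\<close> and the prefactor \<open>q^(2c+2)\<close> alone suffices.\<close>
proof (induction "K - c" arbitrary: c)
  case 0
  then show ?case
    unfolding durfee_sum_rec by (intro fps_X_power_dvd) simp
next
  case (Suc k)
  have d: "fps_X ^ Suc K dvd durfee_sum L (c + 1) - (durfee_sum L (c + 2) :: 'a fps)"
    using Suc(1)[of "c + 1"] Suc(2) by (simp add: add.assoc)
  have "L \<le> L * (L + c + 2)"
    by simp
  then have "fps_X ^ Suc K dvd fps_X ^ (2 * c + 2 + 2 * L * (L + c + 2)) * (inv_poch L * inv_poch (L + c + 2) :: 'a fps)"
    using assms by (intro fps_X_power_dvd) linarith
  from d this have "fps_X ^ Suc K dvd - (fps_X ^ (2 * c + 2)) * (durfee_sum L (c + 1) - durfee_sum L (c + 2))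
     - fps_X ^ (2 * c + 2 + 2 * L * (L + c + 2)) * (inv_poch L * inv_poch (L + c + 2) :: 'a fps)"
    by (rule dvd_diff [OF dvd_mult])
  also have "\<dots> = durfee_sum L c - durfee_sum L (c + 1)"
    unfolding durfee_sum_rec by (simp add: power_add algebra_simps)
  finally show ?case .
qed

lemma durfee_sum_cong_add:
  assumes "K \<le> L"
  shows "fps_X ^ Suc K dvd durfee_sum L c - (durfee_sum L (c + i) :: 'a::field fps)"
proof (induction i)
  case (Suc i)
  from dvd_add[OF Suc durfee_sum_cong_Suc[OF assms, of "c + i"]] show ?case by simp
qed simp

lemma even_poch_cong:
  "fps_X ^ (2 * k + 2) dvd even_poch (k + i) - (even_poch k :: 'a::field fps)"
proof (induction i)
  case (Suc i)
  have "fps_X ^ (2 * k + 2) dvd fps_X ^ (2 * (k + i) + 2) * (even_poch (k + i) :: 'a fps)"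
    by (intro fps_X_power_dvd) simp
  from dvd_diff[OF Suc this] show ?case
    by (simp add: even_poch_Suc algebra_simps)
qed simp

text \<open>Shifting \<open>c\<close> by \<open>K\<close> changes nothing modulo
  \<open>q^(K+1)\<close>. After the shift only the summand \<open>m = 0\<close> survives, and its
  reciprocal cancels against the product.\<close>

lemma even_poch_durfee_sum_cong:
  assumes "K \<le> L" "K \<le> M"
  shows "fps_X ^ Suc K dvd even_poch M * durfee_sum L c - (1 :: 'a::field fps)"
proof -
  let ?c = "c + K"
  let ?X = "fps_X ^ Suc K :: 'a fps"
  let ?P = "even_poch :: nat \<Rightarrow> 'a fps"
  have 1: "?X dvd durfee_sum L c - durfee_sum L ?c"
    by (rule durfee_sum_cong_add[OF assms(1)])
  have "durfee_sum L ?c - inv_poch ?c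
      = (\<Sum>m\<in>{..L} - {0}. fps_X ^ (2 * m * (m + ?c)) * inv_poch m * (inv_poch (m + ?c) :: 'a fps))"
    unfolding durfee_sum_def by (subst sum.remove[of _ 0]) simp_all
  also have "?X dvd \<dots>"
  proof (rule dvd_sum)
    fix m assume "m \<in> {..L} - {0}"
    then have "1 * (1 + K) \<le> 2 * m * (m + ?c)"
      by (intro mult_mono) auto
    then show "?X dvd fps_X ^ (2 * m * (m + ?c)) * inv_poch m * inv_poch (m + ?c)"
      unfolding mult.assoc[of "fps_X ^ _"] by (intro fps_X_power_dvd) simp
  qed
  finally have 2: "?X dvd durfee_sum L ?c - inv_poch ?c" .
  have P: "?X dvd ?P m - ?P K" if "K \<le> m" for m
  proof -
    have "?X dvd fps_X ^ (2 * K + 2) * 1"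
      by (intro fps_X_power_dvd) simp
    also have "\<dots> dvd ?P (K + (m - K)) - ?P K"
      using even_poch_cong by simp
    finally show ?thesis using that by simp
  qed
  have 3: "?X dvd ?P M - ?P ?c"
    using dvd_diff[OF P[OF assms(2)] P[of ?c]] by simp
  have "?P M * durfee_sum L c - 1
     = ?P M * (durfee_sum L c - durfee_sum L ?c) + ?P M * (durfee_sum L ?c - inv_poch ?c)
       + inv_poch ?c * (?P M - ?P ?c)"
    by (simp add: algebra_simps)
  also have "?X dvd \<dots>"
    using 1 2 3 by (intro dvd_add dvd_mult)
  finally show ?thesis .
qed

text \<open>Inserting the Bailey sums and putting \<open>j = m + r\<close> gives a sum over a
  triangle. Enlarging it to a square costs only multiples of \<open>q^(K+1)\<close>, and then each
  row is a Durfee sum. \<open>even_poch M\<close> stands in for the infinite product.\<close>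

lemma rogers_selberg_cong:
  assumes "K \<le> M"
  shows "fps_X ^ Suc K dvd
     (\<Sum>j\<le>K. fps_X ^ (2 * j * (j + 1)) * odd_poch j * even_poch M * inv_poch (2 * j))
     - (\<Sum>r\<le>K. pent_weight r * (1 - fps_X ^ (4 * r + 2)) * fps_X ^ (2 * r * (r + 1)) :: 'a::field fps)"
proof -
  define t :: "nat \<Rightarrow> nat \<Rightarrow> 'a fps" where
    "t = (\<lambda>r m. even_poch M * fps_X ^ (2 * (m + r) * (m + r + 1)) * bailey_term (m + r) r)"
  define h :: "nat \<Rightarrow> 'a fps" where
    "h r = pent_weight r * (1 - fps_X ^ (4 * r + 2)) * fps_X ^ (2 * r * (r + 1))" for r
  have "fps_X ^ (2 * j * (j + 1)) * odd_poch j * even_poch M * inv_poch (2 * j)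
     = (\<Sum>r\<le>j. t r (j - r))" for j
  proof -
    have "fps_X ^ (2 * j * (j + 1)) * odd_poch j * even_poch M * inv_poch (2 * j)
       = even_poch M * fps_X ^ (2 * j * (j + 1)) * bailey_sum j * (even_poch (2 * j) * inv_poch (2 * j))"
      unfolding bailey_sum_eq[symmetric] by (simp only: mult_ac)
    also have "\<dots> = (\<Sum>r\<le>j. t r (j - r))"
      unfolding inv_poch_mult bailey_sum_def sum_distrib_left mult_1_right t_def
      by (intro sum.cong) auto
    finally show ?thesis .
  qed
  then have "(\<Sum>j\<le>K. fps_X ^ (2 * j * (j + 1)) * odd_poch j * even_poch M * inv_poch (2 * j))
     = (\<Sum>j\<le>K. \<Sum>r\<le>j. t r (j - r))"
    by simp
  also have "\<dots> = (\<Sum>(r,m)\<in>{(r,m). r + m \<le> K}. t r m)"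
    by (rule sum.triangle_reindex_eq [symmetric])
  finally have lhs: "(\<Sum>j\<le>K. fps_X ^ (2 * j * (j + 1)) * odd_poch j * even_poch M * inv_poch (2 * j)) = \<dots>" .
  have t: "(\<Sum>m\<le>K. t r m) = h r * (even_poch M * durfee_sum K (2 * r + 1))" for r
  proof -
    have "t r m = h r * (even_poch M * (fps_X ^ (2 * m * (m + (2 * r + 1))) * inv_poch m * inv_poch (m + (2 * r + 1))))" for m
    proof -
      \<comment> \<open>This splitting of the exponent produces the rectangle shift
        \<open>c = 2r + 1\<close>.\<close>
      have "2 * (m + r) * (m + r + 1) = 2 * r * (r + 1) + 2 * m * (m + (2 * r + 1))"
        "m + r + r + 1 = m + (2 * r + 1)"
        by (simp_all add: algebra_simps)
      then show ?thesis
        unfolding t_def h_def bailey_term_def by (simp only: power_add mult_ac add_diff_cancel_right')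
    qed
    then show ?thesis
      by (simp add: durfee_sum_def sum_distrib_left)
  qed
  have square: "fps_X ^ Suc K dvd (\<Sum>r\<le>K. \<Sum>m\<le>K. t r m) - (\<Sum>r\<le>K. h r)"
  proof -
    have "(\<Sum>r\<le>K. \<Sum>m\<le>K. t r m) - (\<Sum>r\<le>K. h r)
        = (\<Sum>r\<le>K. h r * (even_poch M * durfee_sum K (2 * r + 1) - 1))"
      unfolding t by (simp add: algebra_simps sum_subtractf)
    then show ?thesis
      using even_poch_durfee_sum_cong[of K K M] assms by (auto intro!: dvd_sum dvd_mult)
  qed
  have corner: "fps_X ^ Suc K dvd (\<Sum>r\<le>K. \<Sum>m\<le>K. t r m) - (\<Sum>(r,m)\<in>{(r,m). r + m \<le> K}. t r m)"
  proof -
    have "(\<Sum>r\<le>K. \<Sum>m\<le>K. t r m) = (\<Sum>(r,m)\<in>{..K} \<times> {..K}. t r m)"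
      by (simp add: sum.cartesian_product)
    also have "\<dots> - (\<Sum>(r,m)\<in>{(r,m). r + m \<le> K}. t r m)
       = (\<Sum>(r,m)\<in>{..K} \<times> {..K} - {(r,m). r + m \<le> K}. t r m)"
      by (subst sum_diff) auto
    also have "fps_X ^ Suc K dvd \<dots>"
    proof (rule dvd_sum)
      fix p assume "p \<in> {..K} \<times> {..K} - {(r,m). r + m \<le> K}"
      then obtain r m where p: "p = (r, m)" and "\<not> r + m \<le> K"
        by auto
      then have "Suc K * 1 \<le> 2 * (m + r) * (m + r + 1)"
        by (intro mult_mono) auto
      then have "fps_X ^ Suc K dvd fps_X ^ (2 * (m + r) * (m + r + 1)) * (even_poch M * bailey_term (m + r) r)"
        by (intro fps_X_power_dvd) simp
      then show "fps_X ^ Suc K dvd (case p of (r, m) \<Rightarrow> t r m)"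
        by (simp add: p t_def mult_ac)
    qed
    finally show ?thesis .
  qed
  have "fps_X ^ Suc K dvd (\<Sum>(r,m)\<in>{(r,m). r + m \<le> K}. t r m) - (\<Sum>r\<le>K. h r)"
    using dvd_diff [OF square corner] by simp
  then show ?thesis
    unfolding lhs h_def .
qed

section \<open>The generating function of the partitions\<close>

text \<open>Case (a) of the definition is treated as case (b) with \<open>j = 0\<close>. For partitions of \<open>n\<close> the bound
  \<open>2 * M\<close> on the parts is harmless as soon as \<open>n \<le> 2 * M\<close>.\<close>

definition free_parts :: "nat \<Rightarrow> nat \<Rightarrow> nat set" where
  "free_parts M j = {a. odd a \<and> a < 2 * j} \<union> {a. even a \<and> 4 * j + 2 \<le> a \<and> a \<le> 2 * M}"

definition doubled_parts :: "nat \<Rightarrow> nat multiset" where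
  "doubled_parts j = repeat_mset 2 (mset_set ((*) 2 ` {1..j}))"

definition c4_class :: "nat \<Rightarrow> nat \<Rightarrow> nat multiset set" where
  "c4_class n j = {p. is_partition n p \<and> (if j = 0 then c4_condA p else c4_condB j p)}"

lemma finite_free_parts [simp]: "finite (free_parts M j)"
  by (rule finite_subset [of _ "{..2 * j} \<union> {..2 * M}"]) (auto simp: free_parts_def)

lemma count_doubled_parts:
  "count (doubled_parts j) x = (if even x \<and> 0 < x \<and> x \<le> 2 * j then 2 else 0)"
proof -
  have "x \<in> (*) 2 ` {1..j} \<longleftrightarrow> even x \<and> 0 < x \<and> x \<le> 2 * j"
    by (auto elim!: evenE)
  then show ?thesis
    by (simp add: doubled_parts_def count_mset_set')
qed

lemma sum_mset_repeat_mset: "sum_mset (repeat_mset k p) = k * sum_mset (p :: nat multiset)"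
  by (induction k) simp_all

lemma sum_doubled_parts: "sum_mset (doubled_parts j) = 2 * j * (j + 1)"
proof -
  have "sum_mset (doubled_parts j) = 2 * (\<Sum>i=1..j. 2 * i)"
    using sum_unfold_sum_mset [of id "(*) 2 ` {1..j}"]
    by (simp add: doubled_parts_def sum_mset_repeat_mset sum.reindex inj_on_def)
  also have "(\<Sum>i=1..j. 2 * i) = j * (j + 1)"
    by (induction j) auto
  finally show ?thesis by simp
qed

lemma count_le_one_eq_mset_set:
  assumes "\<And>x. count p x \<le> 1"
  shows "mset_set (set_mset p) = p"
proof (rule multiset_eqI)
  fix x
  show "count (mset_set (set_mset p)) x = count p x"
    using assms[of x] by (auto simp: count_mset_set' not_in_iff le_Suc_eq simp flip: count_greater_zero_iff)
qed

lemma c4_class_count: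
  assumes "p \<in> c4_class n j"
  shows "0 < i \<Longrightarrow> i \<le> j \<Longrightarrow> count p (2 * i) = 2"
    and "j < i \<Longrightarrow> count p (2 * i) \<le> 1"
proof -
  show "count p (2 * i) = 2" if "0 < i" "i \<le> j"
    using assms that by (auto simp: c4_class_def c4_condB_def split: if_splits)
  show "count p (2 * i) \<le> 1" if "j < i"
    using assms that
    by (cases "2 * i \<in># p") (auto simp: c4_class_def c4_condA_def c4_condB_def not_in_iff split: if_splits)
qed

text \<open>For \<open>a < b\<close>, the part \<open>2b\<close> occurs at most once in class
  \<open>a\<close> but twice in class \<open>b\<close>.\<close>

lemma c4_class_unique:
  assumes "p \<in> c4_class n j" "p \<in> c4_class n k"
  shows "j = k"
proof -
  have False if "a < b" "p \<in> c4_class n a" "p \<in> c4_class n b" for a b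
    using c4_class_count(2)[OF that(2,1)] c4_class_count(1)[OF that(3), of b] that(1) by simp
  then show ?thesis
    using assms by (meson linorder_neqE_nat)
qed

text \<open>Removing the forced double parts leaves distinct parts, hence a set. The bound on
  \<open>n\<close> ensures that \<open>2 * M\<close> excludes no part.\<close>

lemma c4_class_eq:
  assumes "n \<le> 2 * M"
  shows "c4_class n j = (\<lambda>S. doubled_parts j + mset_set S) `
     {S. S \<subseteq> free_parts M j \<and> 2 * j * (j + 1) + \<Sum>S = n}" (is "_ = ?f ` ?A")
proof (intro equalityI subsetI)
  fix p assume p: "p \<in> c4_class n j"
  define S where "S = set_mset (p - doubled_parts j)"
  have pos: "0 < x" if "x \<in># p" for x
    using p that by (auto simp: c4_class_def is_partition_def)
  have le: "x \<le> n" if "x \<in># p" for x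
    using p sum_mset.remove[OF that] by (simp add: c4_class_def is_partition_def)
  have c: "count p x = (if even x \<and> 0 < x \<and> x \<le> 2 * j then 2
      else if x \<in># p then 1 else 0)" for x
  proof (cases "even x")
    case True
    then obtain i where i: "x = 2 * i" by (elim evenE)
    show ?thesis
      using c4_class_count[OF p, of i] pos[of x] i
      by (cases "i \<le> j") (auto simp: not_in_iff le_Suc_eq simp flip: count_greater_zero_iff)
  next
    case False
    have "count p x \<le> 1" if "x \<in># p"
      using p that False by (auto simp: c4_class_def c4_condA_def c4_condB_def split: if_splits)
    moreover have "0 < count p x" if "x \<in># p"
      using that by simp
    moreover have "count p x = 0" if "x \<notin># p"
      using that by (simp add: not_in_iff)
    ultimately show ?thesis
      using False by (simp add: le_antisym)
  qed
  have sub: "doubled_parts j \<subseteq># p"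
    by (rule mset_subset_eqI) (simp add: c count_doubled_parts)
  have "mset_set S = p - doubled_parts j"
    unfolding S_def by (rule count_le_one_eq_mset_set) (simp add: c count_doubled_parts)
  then have eq: "p = doubled_parts j + mset_set S"
    using sub by simp
  have "S \<subseteq> free_parts M j"
  proof
    fix x assume "x \<in> S"
    then have x: "count (doubled_parts j) x < count p x"
      by (simp add: S_def in_diff_count)
    then have "x \<in># p"
      by (metis count_greater_zero_iff gr_zeroI not_less0)
    then have "\<not> (even x \<and> x \<le> 2 * j)" "x \<le> 2 * M"
      using x pos[of x] le[of x] assms by (auto simp: count_doubled_parts c split: if_splits)
    moreover have "4 * j + 2 \<le> x" if "even x"
    proof (cases "j = 0")
      case True
      have "x \<noteq> 1" using that by auto
      then show ?thesis using True pos[OF \<open>x \<in># p\<close>] by simp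
    next
      case False
      then show ?thesis
        using p \<open>x \<in># p\<close> that calculation(1) by (auto simp: c4_class_def c4_condB_def)
    qed
    moreover have "x < 2 * j" if "odd x"
    proof (cases "j = 0")
      case True
      then show ?thesis
        using p \<open>x \<in># p\<close> that by (auto simp: c4_class_def c4_condA_def)
    next
      case False
      then have "x \<le> 2 * j - 1"
        using p \<open>x \<in># p\<close> that by (auto simp: c4_class_def c4_condB_def)
      then show ?thesis using False by simp
    qed
    ultimately show "x \<in> free_parts M j"
      by (auto simp: free_parts_def)
  qed
  moreover have "2 * j * (j + 1) + \<Sum>S = n"
  proof -
    have "n = sum_mset p" using p by (simp add: c4_class_def is_partition_def)
    also have "\<dots> = 2 * j * (j + 1) + \<Sum>S"
      by (subst eq) (simp add: sum_doubled_parts sum_unfold_sum_mset)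
    finally show ?thesis by simp
  qed
  ultimately show "p \<in> ?f ` ?A"
    using eq by blast
next
  fix p assume "p \<in> ?f ` ?A"
  then obtain S where S: "S \<subseteq> free_parts M j" "2 * j * (j + 1) + \<Sum>S = n"
    and p: "p = doubled_parts j + mset_set S" by blast
  have "finite S"
    using finite_subset[OF S(1)] by simp
  then have c: "count p x = (if even x \<and> 0 < x \<and> x \<le> 2 * j then 2 else 0) + (if x \<in> S then 1 else 0)" for x
    by (simp add: p count_doubled_parts count_mset_set')
  have mem: "x \<in># p \<longleftrightarrow> (even x \<and> 0 < x \<and> x \<le> 2 * j) \<or> x \<in> S" for x
    unfolding count_greater_zero_iff [symmetric] c by simp
  have "sum_mset p = n"
    using S(2) by (simp add: p sum_doubled_parts sum_unfold_sum_mset)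
  moreover have "\<forall>x\<in>#p. 0 < x"
    using S(1) by (auto simp: mem free_parts_def intro!: Nat.gr0I)
  moreover have "if j = 0 then c4_condA p else c4_condB j p"
  proof -
    have free: "(odd x \<and> x < 2 * j) \<or> (even x \<and> 4 * j + 2 \<le> x)" if "x \<in> S" for x
      using S(1) that by (auto simp: free_parts_def)
    have "c4_condA p" if "j = 0"
      unfolding c4_condA_def using free that by (auto simp: mem c)
    moreover have "c4_condB j p" if "j \<noteq> 0"
      unfolding c4_condB_def
    proof (intro conjI ballI impI)
      \<comment> \<open>Even free parts are at least \<open>4j + 2\<close>, so \<open>S\<close> adds
        nothing here.\<close>
      show "count p (2 * i) = 2" if "i \<in> {1..j}" for i
        using free[of "2 * i"] that by (auto simp: c)
      show "4 * j + 2 \<le> x" "count p x \<le> 1" if "x \<in># p" "even x \<and> 2 * j < x" for x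
        using free[of x] that by (auto simp: mem c)
      show "x \<le> 2 * j - 1" "count p x \<le> 1" if "x \<in># p" "odd x" for x
        using free[of x] that by (auto simp: mem c)
      show "1 \<le> j" using that by simp
    qed
    ultimately show ?thesis by simp
  qed
  ultimately show "p \<in> c4_class n j"
    by (simp add: c4_class_def is_partition_def)
qed

lemma card_c4_class:
  assumes "n \<le> 2 * M"
  shows "card (c4_class n j) = card {S. S \<subseteq> free_parts M j \<and> 2 * j * (j + 1) + \<Sum>S = n}"
  unfolding c4_class_eq[OF assms]
proof (rule card_image, rule inj_onI)
  fix S T assume "S \<in> {S. S \<subseteq> free_parts M j \<and> 2 * j * (j + 1) + \<Sum>S = n}"
    "T \<in> {S. S \<subseteq> free_parts M j \<and> 2 * j * (j + 1) + \<Sum>S = n}"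
    "doubled_parts j + mset_set S = doubled_parts j + mset_set T"
  then show "S = T"
    by (metis (no_types, lifting) add_left_cancel finite_free_parts finite_set_mset_mset_set
        finite_subset mem_Collect_eq)
qed

lemma finite_c4_class: "finite (c4_class n j)"
proof -
  have "finite {S. S \<subseteq> free_parts n j \<and> 2 * j * (j + 1) + \<Sum>S = n}"
    by (rule finite_subset[of _ "Pow (free_parts n j)"]) auto
  then show ?thesis
    by (subst c4_class_eq[of n n]) auto
qed

lemma c4_eq_sum: "c4 n = (\<Sum>j\<le>n. card (c4_class n j))"
proof -
  \<comment> \<open>The forced parts alone sum to \<open>2j(j+1)\<close>, so only finitely many
    classes are inhabited.\<close>
  have le: "j \<le> n" if "p \<in> c4_class n j" for p j
  proof -
    from that obtain S where "2 * j * (j + 1) + \<Sum>S = n"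
      by (subst (asm) c4_class_eq[of n n]) auto
    then show ?thesis by simp
  qed
  have "{p. is_partition n p \<and> (c4_condA p \<or> (\<exists>j. c4_condB j p))} = (\<Union>j. c4_class n j)"
  proof (intro equalityI subsetI)
    fix p assume "p \<in> {p. is_partition n p \<and> (c4_condA p \<or> (\<exists>j. c4_condB j p))}"
    then consider "is_partition n p" "c4_condA p" | j where "is_partition n p" "c4_condB j p"
      by blast
    then show "p \<in> (\<Union>j. c4_class n j)"
    proof cases
      case 1
      then have "p \<in> c4_class n 0" by (simp add: c4_class_def)
      then show ?thesis by blast
    next
      case (2 j)
      then have "p \<in> c4_class n j" by (simp add: c4_class_def c4_condB_def)
      then show ?thesis by blast
    qed
  next
    fix p assume "p \<in> (\<Union>j. c4_class n j)"
    then obtain j where "p \<in> c4_class n j" by blast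
    then show "p \<in> {p. is_partition n p \<and> (c4_condA p \<or> (\<exists>j. c4_condB j p))}"
      by (cases "j = 0") (auto simp: c4_class_def)
  qed
  also have "\<dots> = (\<Union>j\<le>n. c4_class n j)"
    using le by auto
  finally have "c4 n = card (\<Union>j\<le>n. c4_class n j)"
    by (simp add: c4_def)
  also have "\<dots> = (\<Sum>j\<le>n. card (c4_class n j))"
    by (rule card_UN_disjoint) (auto simp: finite_c4_class dest: c4_class_unique)
  finally show ?thesis .
qed

section \<open>Products as generating functions of sets of parts\<close>

lemma prod_one_plus_eq_sum_Pow:
  fixes f :: "'b \<Rightarrow> 'a::comm_semiring_1"
  assumes "finite A"
  shows "(\<Prod>a\<in>A. 1 + f a) = (\<Sum>S\<in>Pow A. \<Prod>a\<in>S. f a)"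
  using prod_add[OF assms, of f "\<lambda>_. 1"] by (simp add: add.commute)

lemma fps_nth_prod_one_plus_X:
  assumes "finite A"
  shows "fps_nth (fps_X ^ k * (\<Prod>a\<in>A. 1 + fps_X ^ a)) n
    = (of_nat (card {S. S \<subseteq> A \<and> k + \<Sum>S = n}) :: 'a::comm_ring_1)"
proof -
  have "fps_X ^ k * (\<Prod>a\<in>A. 1 + fps_X ^ a) = (\<Sum>S\<in>Pow A. fps_X ^ (k + \<Sum>S) :: 'a fps)"
    unfolding prod_one_plus_eq_sum_Pow[OF assms] sum_distrib_left
    by (simp add: power_add power_sum)
  then have "fps_nth (fps_X ^ k * (\<Prod>a\<in>A. 1 + fps_X ^ a)) n
      = (\<Sum>S\<in>Pow A. if k + \<Sum>S = n then 1 else (0 :: 'a))"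
    by (simp add: fps_sum_nth fps_X_power_nth eq_commute)
  also have "\<dots> = of_nat (card {S \<in> Pow A. k + \<Sum>S = n})"
    using assms by (simp add: sum.If_cases Int_def)
  finally show ?thesis by simp
qed

text \<open>Since \<open>4j + 2 = 2(2j + 1)\<close>, the even free parts give exactly the factors of
  \<open>even_poch M\<close> beyond the first \<open>2j\<close>.\<close>

lemma prod_free_parts:
  assumes "2 * j \<le> M"
  shows "(\<Prod>a\<in>free_parts M j. 1 - fps_X ^ a)
    = (odd_poch j * even_poch M * inv_poch (2 * j) :: 'a::field fps)"
proof -
  let ?f = "\<lambda>a. 1 - fps_X ^ a :: 'a fps"
  have odds: "{a. odd a \<and> a < 2 * j} = (\<lambda>i. 2 * i - 1) ` {1..j}"
  proof (intro equalityI subsetI)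
    fix a assume "a \<in> {a. odd a \<and> a < 2 * j}"
    then obtain k where "a = 2 * k + 1" "a < 2 * j" by (auto elim: oddE)
    then show "a \<in> (\<lambda>i. 2 * i - 1) ` {1..j}"
      by (intro image_eqI[of _ _ "Suc k"]) auto
  qed auto
  have evens: "{a. even a \<and> 4 * j + 2 \<le> a \<and> a \<le> 2 * M} = (*) 2 ` {2 * j + 1..M}"
    by (auto elim!: evenE)
  have "prod ?f (free_parts M j) = prod ?f {a. odd a \<and> a < 2 * j} * prod ?f {a. even a \<and> 4 * j + 2 \<le> a \<and> a \<le> 2 * M}"
    unfolding free_parts_def by (rule prod.union_disjoint) (auto simp: odds evens)
  also have "prod ?f {a. odd a \<and> a < 2 * j} = odd_poch j"
    unfolding odds odd_poch_def by (subst prod.reindex) (auto simp: inj_on_def)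
  also have "prod ?f {a. even a \<and> 4 * j + 2 \<le> a \<and> a \<le> 2 * M} = (\<Prod>i=2*j+1..M. 1 - fps_X ^ (2 * i))"
    unfolding evens by (subst prod.reindex) (auto simp: inj_on_def)
  also have "\<dots> = even_poch M * inv_poch (2 * j)"
  proof -
    have "even_poch M = even_poch (2 * j) * (\<Prod>i=2*j+1..M. 1 - fps_X ^ (2 * i) :: 'a fps)"
      unfolding even_poch_def
      using prod.ub_add_nat[of 1 "2 * j" "\<lambda>i. 1 - fps_X ^ (2 * i) :: 'a fps" "M - 2 * j"] assms by simp
    then have "even_poch M * inv_poch (2 * j) = (\<Prod>i=2*j+1..M. 1 - fps_X ^ (2 * i))
       * (even_poch (2 * j) * inv_poch (2 * j) :: 'a fps)"
      by (simp only: mult_ac)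
    then show ?thesis by simp
  qed
  finally show ?thesis by (simp only: mult.assoc)
qed

section \<open>Parity as a coefficient over the field with two elements\<close>

lemma of_nat_bit_eq_odd: "(of_nat n :: bit) = of_bool (odd n)"
  by (induction n) auto

lemma fps_bit_diff_eq_add: "f - g = f + (g :: bit fps)"
  by (simp add: fps_eq_iff)

lemma fps_nth_eq_of_X_power_dvd:
  assumes "fps_X ^ Suc n dvd f - (g :: 'a::field fps)"
  shows "fps_nth f n = fps_nth g n"
proof -
  from assms obtain h where "f - g = fps_X ^ Suc n * h" ..
  then have "fps_nth (f - g) n = 0"
    by (simp only: fps_X_power_mult_nth) simp
  then show ?thesis by simp
qed

lemma c4_parity_eq_coeff:
  "of_bool (odd (c4 n))
    = fps_nth (\<Sum>r\<le>n. pent_weight r * (1 - fps_X ^ (4 * r + 2)) * fps_X ^ (2 * r * (r + 1)) :: bit fps) n"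
proof -
  have "of_bool (odd (c4 n)) = (of_nat (c4 n) :: bit)"
    by (rule of_nat_bit_eq_odd [symmetric])
  \<comment> \<open>The choice \<open>M = 2 * n\<close> gives \<open>2 * j\<close> \<le>
    \<open>M\<close> for all \<open>j\<close> \<le> \<open>n\<close>, as
    \<open>prod_free_parts\<close> requires, and also meets the weaker bounds of the other
    lemmas.\<close>
  also have "\<dots> = (\<Sum>j\<le>n. of_nat (card {S. S \<subseteq> free_parts (2 * n) j \<and> 2 * j * (j + 1) + \<Sum>S = n}))"
    by (simp only: c4_eq_sum of_nat_sum card_c4_class [of n "2 * n"])
  also have "\<dots> = (\<Sum>j\<le>n. fps_nth (fps_X ^ (2 * j * (j + 1)) * (\<Prod>a\<in>free_parts (2 * n) j. 1 - fps_X ^ a)) n)"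
    by (simp only: fps_bit_diff_eq_add fps_nth_prod_one_plus_X [OF finite_free_parts])
  also have "\<dots> = fps_nth (\<Sum>j\<le>n. fps_X ^ (2 * j * (j + 1)) * odd_poch j * even_poch (2 * n) * inv_poch (2 * j)) n"
    unfolding fps_sum_nth by (intro sum.cong refl) (simp add: prod_free_parts mult.assoc)
  also have "\<dots> = fps_nth (\<Sum>r\<le>n. pent_weight r * (1 - fps_X ^ (4 * r + 2)) * fps_X ^ (2 * r * (r + 1)) :: bit fps) n"
    by (rule fps_nth_eq_of_X_power_dvd, rule rogers_selberg_cong) simp
  finally show ?thesis .
qed

section \<open>The theta series modulo 2\<close>

text \<open>Twice the exponent of the \<open>j\<close>-th term of the theta series.\<close>

definition theta_exp :: "int \<Rightarrow> int" where
  "theta_exp j = 7 * j^2 + 3 * j"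

text \<open>The difference of two values factors, and the second factor is 3 modulo 7, hence
  nonzero.\<close>

lemma inj_theta_exp: "inj theta_exp"
proof (rule injI)
  fix j k assume "theta_exp j = theta_exp k"
  then have "(j - k) * (7 * (j + k) + 3) = 0"
    by (simp add: theta_exp_def algebra_simps power2_eq_square)
  moreover have "7 * (j + k) + 3 \<noteq> 0" by presburger
  ultimately show "j = k" by simp
qed

text \<open>The two terms of \<open>1 - q^(4r+2)\<close> belong to the theta indices
  \<open>r\<close> and \<open>-r - 1\<close>, which together run through all integers.\<close>

lemma pent_weight_bit_expand:
  "pent_weight r * (1 - fps_X ^ (4 * r + 2)) * fps_X ^ (2 * r * (r + 1))
    = (fps_X ^ nat (theta_exp (int r) div 2) + fps_X ^ nat (theta_exp (- int r - 1) div 2) :: bit fps)"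
proof -
  define k where "k = r * (3 * r - 1) div 2"
  have "even (r * (3 * r - 1))"
    by (cases "even r") auto
  then have k: "2 * k = r * (3 * r - 1)"
    by (simp add: k_def)
  have k: "2 * int k = 3 * (int r)^2 - int r"
    using arg_cong[OF k, of int] by (cases r) (simp_all add: algebra_simps power2_eq_square)
  have h: "theta_exp (int r) = 2 * int (k + 2 * r * (r + 1))"
    "theta_exp (- int r - 1) = 2 * int (k + 2 * r * (r + 1) + (4 * r + 2))"
    using k by (simp_all add: theta_exp_def algebra_simps power2_eq_square)
  have "(-1) ^ r = (1 :: bit fps)"
  proof -
    have "(-1 :: bit fps) = 1" by (simp add: fps_eq_iff)
    then show ?thesis by (simp only: power_one)
  qed
  then have "pent_weight r = (fps_X ^ k :: bit fps)"
    by (simp only: pent_weight_def k_def mult_1_left)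
  then show ?thesis
    unfolding h nonzero_mult_div_cancel_left[OF zero_neq_numeral[symmetric]] nat_int
      fps_bit_diff_eq_add power_add by (simp only: distrib_left distrib_right mult_1_left mult_1_right mult_ac)
qed

lemma even_theta_exp: "even (theta_exp j)"
  by (auto simp: theta_exp_def)

lemma theta_exp_nonneg: "0 \<le> theta_exp j"
proof -
  have "0 \<le> j * (7 * j + 3)"
    by (cases "j \<ge> 0") (auto intro: mult_nonneg_nonneg mult_nonpos_nonpos)
  then show ?thesis by (simp add: theta_exp_def algebra_simps power2_eq_square)
qed

text \<open>Guarantees that cutting the sum off at \<open>r\<close> \<le> \<open>n\<close> loses no
  index contributing to the coefficient of \<open>q^n\<close>.\<close>

lemma theta_exp_index_bound:
  assumes "theta_exp j = 2 * int n"
  shows "\<bar>j\<bar> \<le> int n"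
proof -
  have "2 * \<bar>j\<bar> \<le> 7 * \<bar>j\<bar> * \<bar>j\<bar> - 3 * \<bar>j\<bar>"
  proof (cases "j = 0")
    case False
    then have "5 * \<bar>j\<bar> * 1 \<le> 5 * \<bar>j\<bar> * \<bar>j\<bar>"
      by (intro mult_left_mono) auto
    then show ?thesis by simp
  qed simp
  also have "\<dots> \<le> theta_exp j"
    by (simp add: theta_exp_def power2_eq_square abs_if)
  finally show ?thesis using assms by simp
qed

text \<open>By injectivity at most one index contributes, so nothing cancels modulo 2.\<close>

lemma coeff_pent_sum:
  "fps_nth (\<Sum>r\<le>n. pent_weight r * (1 - fps_X ^ (4 * r + 2)) * fps_X ^ (2 * r * (r + 1)) :: bit fps) n
    = of_bool (\<exists>j. 2 * int n = theta_exp j)"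
proof -
  \<comment> \<open>This is the interval from \<open>-n - 1\<close> to \<open>n\<close>; the two
    images are its nonnegative and negative halves.\<close>
  define J where "J = int ` {..n} \<union> (\<lambda>r. - int r - 1) ` {..n}"
  have nth: "fps_nth (fps_X ^ nat (theta_exp j div 2)) n = (of_bool (2 * int n = theta_exp j) :: bit)" for j
  proof -
    have "n = nat (theta_exp j div 2) \<longleftrightarrow> 2 * int n = theta_exp j"
      using theta_exp_nonneg[of j] even_theta_exp[of j] by auto
    then show ?thesis by (simp add: fps_X_power_nth)
  qed
  have "fps_nth (\<Sum>r\<le>n. pent_weight r * (1 - fps_X ^ (4 * r + 2)) * fps_X ^ (2 * r * (r + 1)) :: bit fps) n
     = (\<Sum>r\<le>n. of_bool (2 * int n = theta_exp (int r))) + (\<Sum>r\<le>n. of_bool (2 * int n = theta_exp (- int r - 1)))"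
    by (simp only: pent_weight_bit_expand fps_sum_nth fps_add_nth nth sum.distrib)
  also have "\<dots> = (\<Sum>j\<in>J. of_bool (2 * int n = theta_exp j))"
  proof -
    have "sum f J = (\<Sum>r\<le>n. f (int r)) + (\<Sum>r\<le>n. f (- int r - 1))" for f :: "int \<Rightarrow> bit"
    proof -
      have "sum f J = sum f (int ` {..n}) + sum f ((\<lambda>r. - int r - 1) ` {..n})"
        unfolding J_def by (rule sum.union_disjoint) auto
      then show ?thesis
        by (simp only: sum.reindex inj_on_def o_def diff_left_imp_eq) (simp add: sum.reindex inj_on_def o_def)
    qed
    then show ?thesis by (simp only:)
  qed
  also have "\<dots> = of_bool (\<exists>j. 2 * int n = theta_exp j)"
  proof (cases "\<exists>j. 2 * int n = theta_exp j")
    case True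
    then obtain j where j: "2 * int n = theta_exp j" by blast
    then have "\<bar>j\<bar> \<le> int n"
      using theta_exp_index_bound by simp
    then have "j \<in> J"
      unfolding J_def by (cases "j \<ge> 0") (auto intro: image_eqI[of _ _ "nat j"] image_eqI[of _ _ "nat (- j - 1)"])
    have "finite J" by (simp add: J_def)
    have "(2 * int n = theta_exp i) = (i = j)" for i
      using inj_theta_exp by (auto simp: j inj_eq)
    then have "(\<Sum>i\<in>J. of_bool (2 * int n = theta_exp i)) = (\<Sum>i\<in>J. if i = j then 1 else (0 :: bit))"
      by (intro sum.cong) auto
    also have "\<dots> = 1"
      using \<open>finite J\<close> \<open>j \<in> J\<close> by (simp only: sum.delta if_True)
    finally show ?thesis using True by simp
  qed simp
  finally show ?thesis .
qed

theorem theorem5: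
  fixes n :: nat
  shows "odd (c4 n) \<longleftrightarrow> (\<exists>j::int. 2 * int n = 7 * j^2 + 3 * j)"
proof -
  have "(of_bool (odd (c4 n)) :: bit) = of_bool (\<exists>j. 2 * int n = theta_exp j)"
    unfolding c4_parity_eq_coeff coeff_pent_sum ..
  then show ?thesis
    by (simp only: of_bool_eq_iff theta_exp_def)
qed

end
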